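(* Let $m\ge 1$ be an integer, and let a finite stream of distinct edges $e_1,\dots,e_N$ of a bipartite graph be processed by the adaptive priority sampling scheme with reservoir size $m$ (defined in the context), with sampled edge sets $\hat K_t$, weights $w_{i,t}$, thresholds $z_t$ and edge estimators $\hat S_{i,t}=I(i\in\hat K_t)/q_{i,t}$, where $$q_{i,t}=\min\Big\{1,\ \min_{i\le s\le t}\frac{w_{i,s}}{z_s}\Big\}.$$ Let $S_{i,t}=1$ if $t\ge i$ and $S_{i,t}=0$ otherwise. Then for all $i,t\in\{1,\dots,N\}$, $\hat S_{i,t}$ is an unbiased estimator of $S_{i,t}$, i.e. $\mathbb{E}[\hat S_{i,t}]=S_{i,t}$.
   Context: Adaptive priority sampling scheme. The edge stream $e_1,\dots,e_N$ is fixed (deterministic, arbitrary order) and edges are distinct; edge $e_i$ is identified with its arrival index $i$. All randomness comes from independent random variables $\beta_1,\dots,\beta_N$, each uniformly distributed on $(0,1]$; $\beta_i$ is attached to edge $i$. Let $\hat K_0=\emptyset$. When edge $t$ arrives, it is provisionally admitted, giving $\hat K'_t=\hat K_{t-1}\cup\{t\}$. Each edge $i\in\hat K'_t$ has a weight $w_{i,t}>0$ at time $t$; the weight is determined by the edge stream and the sample history $\hat K'_1,\dots,\hat K'_t$. (The example to have in mind: for $e_i=(u,v)$, $w_{i,t}$ is the sum of the degrees of $u$ and $v$ in the graph whose edge set is $\hat K'_t$; or the value of this quantity at time $t=i$, kept fixed thereafter.) The priority of $i\in\hat K'_t$ at time $t$ is $r_{i,t}=w_{i,t}/\beta_i$.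 If $t\le m$, nothing is discarded: $\hat K_t=\hat K'_t$, and the threshold is $z_t=0$. If $t>m$, the threshold is $z_t=\min_{j\in\hat K'_t}r_{j,t}$, and $\hat K_t$ is obtained from $\hat K'_t$ by discarding the edge of minimal priority (ties, which occur with probability zero, are broken arbitrarily). Thus $|\hat K_t|=m$ for $t\ge m$. Conventions: $w/0=+\infty$ for $w>0$. An edge, once discarded, never returns, so if $i\in\hat K_t$ with $t\ge i$, then $i\in\hat K'_s$ for all $s\in[i,t]$ and $q_{i,t}$ is well defined. $I(\cdot)$ is the indicator function, and $\hat S_{i,t}=0$ whenever $i\notin\hat K_t$ (in particular whenever $t<i$). *)

theory Defs
  imports "HOL-Probability.Probability"
begin

text \<open>
  Edges are identified with their arrival indices \<open>1, ..., length es\<close>, where \<open>es\<close> is the edge stream.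
  A sampling process is a map \<open>K\<close>, with \<open>K t \<omega>\<close> the set of edges retained after the arrival
  of edge \<open>t\<close> at the outcome \<open>\<omega>\<close>.
\<close>

type_synonym 'v edge_stream = "('v \<times> 'v) list"

text \<open>
  A weight rule computes the weight of an edge at time \<open>t\<close> from the edge stream and the list
  of the provisional samples at times \<open>1, ..., t\<close>; the time \<open>t\<close> is the length of that list.
\<close>

type_synonym 'v weight_rule = "'v edge_stream \<Rightarrow> nat set list \<Rightarrow> nat \<Rightarrow> real"

definition provisional_sample :: "(nat \<Rightarrow> 'a \<Rightarrow> nat set) \<Rightarrow> nat \<Rightarrow> 'a \<Rightarrow> nat set" where
  "provisional_sample K t \<omega> = K (t - 1) \<omega> \<union> {t}"

definition sample_history :: "(nat \<Rightarrow> 'a \<Rightarrow> nat set) \<Rightarrow> nat \<Rightarrow> 'a \<Rightarrow> nat set list" where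
  "sample_history K t \<omega> = map (\<lambda>s. provisional_sample K s \<omega>) [1..<Suc t]"

definition weight ::
  "'v edge_stream \<Rightarrow> 'v weight_rule \<Rightarrow> (nat \<Rightarrow> 'a \<Rightarrow> nat set) \<Rightarrow> nat \<Rightarrow> nat \<Rightarrow> 'a \<Rightarrow> real" where
  "weight es W K i t \<omega> = W es (sample_history K t \<omega>) i"

definition priority ::
  "'v edge_stream \<Rightarrow> 'v weight_rule \<Rightarrow> (nat \<Rightarrow> 'a \<Rightarrow> real) \<Rightarrow> (nat \<Rightarrow> 'a \<Rightarrow> nat set) \<Rightarrow>
     nat \<Rightarrow> nat \<Rightarrow> 'a \<Rightarrow> real" where
  "priority es W \<beta> K i t \<omega> = weight es W K i t \<omega> / \<beta> i \<omega>"

definition threshold ::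
  "nat \<Rightarrow> 'v edge_stream \<Rightarrow> 'v weight_rule \<Rightarrow> (nat \<Rightarrow> 'a \<Rightarrow> real) \<Rightarrow> (nat \<Rightarrow> 'a \<Rightarrow> nat set) \<Rightarrow>
     nat \<Rightarrow> 'a \<Rightarrow> real" where
  "threshold m es W \<beta> K t \<omega> =
     (if t \<le> m then 0
      else Min ((\<lambda>j. priority es W \<beta> K j t \<omega>) ` provisional_sample K t \<omega>))"

text \<open>
  The scheme is a relation rather than a recursive function, so that ties between minimal
  priorities may be broken in any way, possibly depending on \<open>\<omega>\<close>. Measurability of the samples is
  therefore not automatic: it is part of the definition.
\<close>

definition adaptive_priority_sampling ::
  "'a measure \<Rightarrow> nat \<Rightarrow> 'v edge_stream \<Rightarrow> 'v weight_rule \<Rightarrow> (nat \<Rightarrow> 'a \<Rightarrow> real) \<Rightarrow>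
     (nat \<Rightarrow> 'a \<Rightarrow> nat set) \<Rightarrow> bool" where
  "adaptive_priority_sampling M m es W \<beta> K \<longleftrightarrow>
     (\<forall>t\<in>{1..length es}. K t \<in> M \<rightarrow>\<^sub>M count_space UNIV) \<and>
     (\<forall>\<omega>\<in>space M.
        K 0 \<omega> = {} \<and>
        (\<forall>t\<in>{1..length es}.
           (\<forall>i\<in>provisional_sample K t \<omega>. weight es W K i t \<omega> > 0) \<and>
           (if t \<le> m then K t \<omega> = provisional_sample K t \<omega>
            else \<exists>j\<in>provisional_sample K t \<omega>.
                   priority es W \<beta> K j t \<omega> = threshold m es W \<beta> K t \<omega> \<and>
                   K t \<omega> = provisional_sample K t \<omega> - {j})))"

text \<open>
  The quotient is taken in the extended reals, where \<open>w / 0 = \<infinity>\<close> for \<open>w > 0\<close>.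
\<close>

definition inclusion_prob ::
  "nat \<Rightarrow> 'v edge_stream \<Rightarrow> 'v weight_rule \<Rightarrow> (nat \<Rightarrow> 'a \<Rightarrow> real) \<Rightarrow> (nat \<Rightarrow> 'a \<Rightarrow> nat set) \<Rightarrow>
     nat \<Rightarrow> nat \<Rightarrow> 'a \<Rightarrow> real" where
  "inclusion_prob m es W \<beta> K i t \<omega> =
     real_of_ereal (min 1 (INF s\<in>{i..t}.
       ereal (weight es W K i s \<omega>) / ereal (threshold m es W \<beta> K s \<omega>)))"

definition edge_estimator ::
  "nat \<Rightarrow> 'v edge_stream \<Rightarrow> 'v weight_rule \<Rightarrow> (nat \<Rightarrow> 'a \<Rightarrow> real) \<Rightarrow> (nat \<Rightarrow> 'a \<Rightarrow> nat set) \<Rightarrow>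
     nat \<Rightarrow> nat \<Rightarrow> 'a \<Rightarrow> real" where
  "edge_estimator m es W \<beta> K i t \<omega> =
     indicator (K t \<omega>) i / inclusion_prob m es W \<beta> K i t \<omega>"

definition edge_indicator :: "nat \<Rightarrow> nat \<Rightarrow> real" where
  "edge_indicator i t = (if t \<ge> i then 1 else 0)"

text \<open>
  Integrability is explicit because the Bochner integral of a non-integrable function is \<open>0\<close>.
\<close>

definition unbiased_estimator :: "'a measure \<Rightarrow> ('a \<Rightarrow> real) \<Rightarrow> real \<Rightarrow> bool" where
  "unbiased_estimator M X \<theta> \<longleftrightarrow> integrable M X \<and> integral\<^sup>L M X = \<theta>"

end

theory Submission
  imports Defs
begin

text \<open>
  Fix an edge \<open>i\<close> and consider the \<^emph>\<open>forced\<close> scheme, in which \<open>i\<close> is exempt from being discarded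
  once it has arrived. Its history depends only on the variables \<open>\<beta>\<^sub>j\<close> with \<open>j \<noteq> i\<close>, and so does
  \<open>Q = min (1, min\<^bsub>i \<le> s \<le> t\<^esub> w\<^bsub>i,s\<^esub> / z\<^sub>s)\<close>, where weights and thresholds are those of the forced
  scheme and \<open>i\<close> does not compete for the minimum \<open>z\<^sub>s\<close>. The forced and the actual scheme agree as
  long as \<open>i\<close> survives, so outside the null set of ties, \<open>i\<close> is retained at time \<open>t\<close> iff
  \<open>\<beta>\<^sub>i \<le> Q\<close>, and then \<open>q\<^bsub>i,t\<^esub> = Q\<close>. As \<open>\<beta>\<^sub>i\<close> is uniform and independent of \<open>Q\<close>, the
  estimator has conditional expectation \<open>Q / Q = 1\<close> given \<open>Q\<close>.
\<close>

subsection \<open>The forced scheme\<close>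

text \<open>One formula for two quantities: with the actual history and \<open>X = {}\<close> it is
  \<open>inclusion_prob\<close>; with the forced history and \<open>X = {i}\<close> it is the cap
  \<open>Q\<close>, in which \<open>i\<close> does not compete for the minimum.\<close>

definition ratio_cap ::
  "nat \<Rightarrow> (nat set list \<Rightarrow> nat \<Rightarrow> real) \<Rightarrow> (nat \<Rightarrow> nat set list) \<Rightarrow> (nat \<Rightarrow> real) \<Rightarrow> nat set \<Rightarrow>
     nat \<Rightarrow> nat \<Rightarrow> real" where
  "ratio_cap m w H u X i t =
     real_of_ereal (min 1 (INF s\<in>{i..t}. ereal (w (H s) i) /
       ereal (if s \<le> m then 0 else Min ((\<lambda>j. w (H s) j / u j) ` (last (H s) - X)))))"

text \<open>
  Removing all minimal elements instead of one avoids a choice of tie-breaking rule; almost surely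
  there is only one.
\<close>

definition forced_kept ::
  "nat \<Rightarrow> (nat set list \<Rightarrow> nat \<Rightarrow> real) \<Rightarrow> nat \<Rightarrow> (nat \<Rightarrow> real) \<Rightarrow> nat set list \<Rightarrow> nat set" where
  "forced_kept m w i u h =
     (if length h \<le> m then {1..length h}
      else {j \<in> last h. j = i \<or> (\<exists>k\<in>last h - {i}. w h k / u k < w h j / u j)})"

text \<open>Entries are provisional samples, as in \<open>sample_history\<close>. The value
  \<open>u i\<close> never influences the result, since the comparisons decide only about edges
  other than \<open>i\<close>.\<close>

primrec forced_history ::
  "nat \<Rightarrow> (nat set list \<Rightarrow> nat \<Rightarrow> real) \<Rightarrow> nat \<Rightarrow> (nat \<Rightarrow> real) \<Rightarrow> nat \<Rightarrow> nat set list" where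
  "forced_history m w i u 0 = []"
| "forced_history m w i u (Suc t) =
     forced_history m w i u t @ [insert (Suc t) (forced_kept m w i u (forced_history m w i u t))]"

section \<open>Elementary facts on histories and extended reals\<close>

lemma length_forced_history [simp]: "length (forced_history m w i u t) = t"
  by (induction t) auto

lemma sample_history_Suc:
  "sample_history K (Suc t) \<omega> = sample_history K t \<omega> @ [provisional_sample K (Suc t) \<omega>]"
  by (simp add: sample_history_def)

lemma length_sample_history [simp]: "length (sample_history K t \<omega>) = t"
  by (simp add: sample_history_def)

lemma last_sample_history:
  "t \<ge> 1 \<Longrightarrow> last (sample_history K t \<omega>) = provisional_sample K t \<omega>"
  by (cases t) (auto simp: sample_history_Suc)

lemma INF_attained:
  fixes f :: "'b \<Rightarrow> 'c :: complete_linorder"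
  assumes "finite A" "A \<noteq> {}"
  shows "\<exists>x\<in>A. (INF x\<in>A. f x) = f x"
proof -
  have "(INF x\<in>A. f x) = Min (f ` A)"
    using assms by (intro Min_Inf[symmetric]) auto
  also have "\<dots> \<in> f ` A" using assms by (intro Min_in) auto
  finally show ?thesis by auto
qed

text \<open>Turns a bound on the random variable by the ratio of weight to threshold into a bound on
  the threshold by the priority.\<close>

lemma le_ereal_divide_iff:
  fixes a x y :: real
  assumes "0 < a" "0 < x" "0 < y"
  shows "ereal x \<le> ereal a / ereal y \<longleftrightarrow> y \<le> a / x"
  using assms by (simp add: field_simps)

text \<open>One fixed outcome without ties: the discarded edge lies strictly below all others in
  priority. Positivity of \<open>w\<close> is assumed for all histories, because the forced scheme
  may reach histories that the actual one does not.\<close>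

locale priority_sampled_path =
  fixes N m :: nat and w :: "nat set list \<Rightarrow> nat \<Rightarrow> real" and u :: "nat \<Rightarrow> real"
    and K :: "nat \<Rightarrow> 'a \<Rightarrow> nat set" and \<omega> :: 'a
  assumes m_pos: "m \<ge> 1"
    and w_pos: "w h j > 0"
    and u_pos: "j \<in> {1..N} \<Longrightarrow> u j > 0"
    and K_0: "K 0 \<omega> = {}"
    and K_fill: "t \<in> {1..N} \<Longrightarrow> t \<le> m \<Longrightarrow> K t \<omega> = provisional_sample K t \<omega>"
    and K_discard: "t \<in> {1..N} \<Longrightarrow> m < t \<Longrightarrow> \<exists>j\<in>provisional_sample K t \<omega>.
      K t \<omega> = provisional_sample K t \<omega> - {j} \<and>
      (\<forall>k\<in>provisional_sample K t \<omega> - {j}.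
         w (sample_history K t \<omega>) j / u j < w (sample_history K t \<omega>) k / u k)"
begin

section \<open>Samples along one path\<close>

abbreviation P where "P t \<equiv> provisional_sample K t \<omega>"
abbreviation H where "H t \<equiv> sample_history K t \<omega>"
abbreviation r where "r t j \<equiv> w (H t) j / u j"

lemma P_Suc: "P (Suc t) = insert (Suc t) (K t \<omega>)"
  by (auto simp: provisional_sample_def)

lemma K_subset_P: "t \<in> {1..N} \<Longrightarrow> K t \<omega> \<subseteq> P t"
  using K_fill[of t] K_discard[of t] by (cases "t \<le> m") auto

lemma K_bound: "t \<le> N \<Longrightarrow> K t \<omega> \<subseteq> {1..t}"
proof (induction t)
  case (Suc t)
  then show ?case using K_subset_P[of "Suc t"] by (fastforce simp: P_Suc)
qed (simp add: K_0)

lemma P_bound: "1 \<le> t \<Longrightarrow> t \<le> N \<Longrightarrow> P t \<subseteq> {1..t}"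
  using K_bound[of "t - 1"] by (cases t) (auto simp: P_Suc)

lemma finite_P: "1 \<le> t \<Longrightarrow> t \<le> N \<Longrightarrow> finite (P t)"
  using P_bound finite_subset by blast

lemma K_full: "t \<le> N \<Longrightarrow> t \<le> m \<Longrightarrow> K t \<omega> = {1..t}"
proof (induction t)
  case (Suc t)
  then show ?case using K_fill[of "Suc t"] by (auto simp: P_Suc)
qed (simp add: K_0)

text \<open>Ensures that an arriving edge \<open>i\<close> meets a competitor. As
  \<open>m \<ge> 1\<close>, a discard happens only when the new edge has joined at least one older
  edge, so something remains.\<close>

lemma K_nonempty: "1 \<le> t \<Longrightarrow> t \<le> N \<Longrightarrow> K t \<omega> \<noteq> {}"
proof (induction t)
  case (Suc t)
  show ?case
  proof (cases "Suc t \<le> m")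
    case True
    then show ?thesis using K_full[of "Suc t"] Suc.prems by auto
  next
    case False
    with m_pos have t: "1 \<le> t" by simp
    with Suc obtain x where x: "x \<in> K t \<omega>" by auto
    moreover have "x \<noteq> Suc t" using x K_bound[of t] Suc.prems by auto
    ultimately show ?thesis
      using K_discard[of "Suc t"] False Suc.prems by (auto simp: P_Suc)
  qed
qed simp

lemma K_antimono: "1 \<le> i \<Longrightarrow> i \<le> s \<Longrightarrow> s \<le> t \<Longrightarrow> t \<le> N \<Longrightarrow> i \<in> K t \<omega> \<Longrightarrow> i \<in> K s \<omega>"
proof (induction t)
  case (Suc t)
  show ?case
  proof (cases "s = Suc t")
    case False
    then have "i \<in> K t \<omega>" using Suc.prems K_subset_P[of "Suc t"] by (auto simp: P_Suc)
    then show ?thesis using Suc False by auto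
  qed (use Suc in auto)
qed simp

text \<open>While \<open>i\<close> survives, the discarded edge is the strict minimum of the whole
  provisional sample and differs from \<open>i\<close>, hence it is what the forced scheme discards
  too. Survival is assumed strictly before \<open>t\<close> because the last entry is the
  provisional sample, fixed before the discard at \<open>t\<close>; so the histories still agree at
  the very time when \<open>i\<close> is lost.\<close>

lemma forced_history_eq:
  assumes b: "\<And>j. j \<in> {1..N} - {i} \<Longrightarrow> b j = u j"
  shows "t \<le> N \<Longrightarrow> (\<And>s. i \<le> s \<Longrightarrow> s < t \<Longrightarrow> i \<in> K s \<omega>) \<Longrightarrow> forced_history m w i b t = H t"
proof (induction t)
  case 0
  then show ?case by (simp add: sample_history_def)
next
  case (Suc t)
  have IH: "forced_history m w i b t = H t"
    using Suc.IH Suc.prems by auto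
  have "forced_kept m w i b (H t) = K t \<omega>"
  proof (cases "t \<le> m")
    case True
    then show ?thesis using K_full[of t] Suc.prems by (simp add: forced_kept_def)
  next
    case False
    then have t: "1 \<le> t" "t \<le> N" "m < t" using m_pos Suc.prems by auto
    obtain j where j: "j \<in> P t" "K t \<omega> = P t - {j}" "\<And>k. k \<in> P t - {j} \<Longrightarrow> r t j < r t k"
      using K_discard[of t] t by auto
    have ji: "j \<noteq> i"
    proof
      assume "j = i"
      moreover from this have "i \<le> t" using j P_bound[of t] t by auto
      ultimately show False using Suc.prems(2)[of t] j by auto
    qed
    have bu: "b k = u k" if "k \<in> P t - {i}" for k
      using that P_bound[of t] t b by fastforce
    \<comment> \<open>Both inclusions rest on \<open>j\<close>: no edge lies strictly below it, and
      for every other edge it is itself the witness \<open>k\<close>.\<close>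
    have "{l \<in> P t. l = i \<or> (\<exists>k\<in>P t - {i}. w (H t) k / b k < w (H t) l / b l)} = P t - {j}"
    proof (intro set_eqI iffI)
      fix l assume l: "l \<in> {l \<in> P t. l = i \<or> (\<exists>k\<in>P t - {i}. w (H t) k / b k < w (H t) l / b l)}"
      have "l \<noteq> j"
      proof
        assume "l = j"
        with l ji obtain k where "k \<in> P t - {i}" "r t k < r t j" using bu j(1) by auto
        with j(3)[of k] show False by (cases "k = j") auto
      qed
      with l show "l \<in> P t - {j}" by simp
    next
      fix l assume l: "l \<in> P t - {j}"
      have "j \<in> P t - {i}" using j(1) ji by simp
      moreover have "w (H t) j / b j < w (H t) l / b l" if "l \<noteq> i"
        using j(3)[OF l] bu[of l] bu[of j] l that calculation by simp
      ultimately show "l \<in> {l \<in> P t. l = i \<or> (\<exists>k\<in>P t - {i}. w (H t) k / b k < w (H t) l / b l)}"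
        using l by auto
    qed
    then show ?thesis using t j by (simp add: forced_kept_def last_sample_history)
  qed
  then show ?case by (simp add: IH sample_history_Suc P_Suc)
qed

section \<open>The forced cap decides survival\<close>

context
  fixes i t :: nat and b :: "nat \<Rightarrow> real"
  assumes i: "1 \<le> i" and it: "i \<le> t" and tN: "t \<le> N"
    and b: "\<And>j. j \<in> {1..N} - {i} \<Longrightarrow> b j = u j"
begin

abbreviation F where "F s \<equiv> forced_history m w i b s"
abbreviation z where "z s \<equiv> Min ((\<lambda>j. w (F s) j / b j) ` (last (F s) - {i}))"

lemma forced_bound: "1 \<le> s \<Longrightarrow> last (F s) \<subseteq> {1..s}"
proof (induction s)
  case (Suc s)
  have "forced_kept m w i b (F s) \<subseteq> {1..s}"
    using Suc m_pos by (cases "s = 0") (auto simp: forced_kept_def)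
  then show ?case by force
qed simp

text \<open>When \<open>i\<close> arrives the two schemes have not yet diverged, so an edge of the
  actual sample is a competitor; later the newly arrived edge \<open>s\<close> is one.\<close>

lemma forced_nonempty:
  assumes "i \<le> s" "m < s" "s \<le> N"
  shows "last (F s) - {i} \<noteq> {}"
proof (cases "s = i")
  case True
  have "F i = H i"
    using assms by (intro forced_history_eq b) auto
  moreover obtain k where "k \<in> K (i - 1) \<omega>"
    using K_nonempty[of "i - 1"] True assms m_pos by fastforce
  moreover have "k \<noteq> i" using calculation K_bound[of "i - 1"] i assms by force
  ultimately show ?thesis using True i by (auto simp: last_sample_history provisional_sample_def)
next
  case False
  then obtain s' where "s = Suc s'" using assms by (cases s) auto
  then show ?thesis using False by auto
qed

lemma z_pos:
  assumes "i \<le> s" "m < s" "s \<le> N"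
  shows "z s > 0"
proof -
  have s: "1 \<le> s" using assms by auto
  have "finite (last (F s))" using forced_bound[OF s] finite_subset by blast
  moreover have "w (F s) j / b j > 0" if "j \<in> last (F s) - {i}" for j
  proof -
    have "j \<in> {1..N} - {i}" using that forced_bound[OF s] assms by auto
    then show ?thesis using b u_pos w_pos by simp
  qed
  ultimately show ?thesis using forced_nonempty[OF assms] by (subst Min_gr_iff) auto
qed

abbreviation T where "T s \<equiv> ereal (w (F s) i) / ereal (if s \<le> m then 0 else z s)"

lemma T_pos: "i \<le> s \<Longrightarrow> s \<le> N \<Longrightarrow> T s > 0"
  using z_pos[of s] w_pos[of "F s" i] by (auto simp: zero_less_divide_iff)

text \<open>The infimum runs over a finite set and is attained, hence positive; truncation at 1
  makes it finite, so \<open>real_of_ereal\<close> loses nothing.\<close>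

lemma cap_ereal: "ereal (ratio_cap m w F b {i} i t) = min 1 (INF s\<in>{i..t}. T s)"
  and cap_pos: "ratio_cap m w F b {i} i t > 0"
  and cap_le_1: "ratio_cap m w F b {i} i t \<le> 1"
proof -
  obtain s where s: "s \<in> {i..t}" "(INF s\<in>{i..t}. T s) = T s" using INF_attained[of "{i..t}" T] it by auto
  then have pos: "0 < (INF s\<in>{i..t}. T s)" using T_pos tN by auto
  show eq: "ereal (ratio_cap m w F b {i} i t) = min 1 (INF s\<in>{i..t}. T s)"
    unfolding ratio_cap_def
  proof (intro ereal_real')
    show "\<bar>min 1 (INF s\<in>{i..t}. T s)\<bar> \<noteq> \<infinity>"
      using pos by (cases "INF s\<in>{i..t}. T s") (auto simp: min_def simp del: Inf_eq_MInfty)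
  qed
  have "ereal 0 < ereal (ratio_cap m w F b {i} i t)" unfolding eq using pos by (simp add: zero_ereal_def[symmetric])
  then show "ratio_cap m w F b {i} i t > 0" by simp
  have "ereal (ratio_cap m w F b {i} i t) \<le> ereal 1" unfolding eq by (simp add: one_ereal_def[symmetric])
  then show "ratio_cap m w F b {i} i t \<le> 1" by simp
qed

text \<open>Since \<open>u i \<le> 1\<close>, the truncation at 1 imposes nothing. What remains says
  that at each time beyond \<open>m\<close> the priority of \<open>i\<close> reaches the smallest
  priority among its competitors.\<close>

lemma le_cap_iff:
  assumes "u i \<le> 1"
  shows "u i \<le> ratio_cap m w F b {i} i t \<longleftrightarrow> (\<forall>s\<in>{i..t}. m < s \<longrightarrow> z s \<le> w (F s) i / u i)"
proof -
  have ui: "0 < u i" using u_pos i it tN by auto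
  have "u i \<le> ratio_cap m w F b {i} i t \<longleftrightarrow> ereal (u i) \<le> min 1 (INF s\<in>{i..t}. T s)"
    unfolding cap_ereal[symmetric] by simp
  also have "\<dots> \<longleftrightarrow> (\<forall>s\<in>{i..t}. ereal (u i) \<le> T s)"
    using assms by (simp only: min.bounded_iff le_INF_iff one_ereal_def ereal_less_eq simp_thms)
  also have "\<dots> \<longleftrightarrow> (\<forall>s\<in>{i..t}. m < s \<longrightarrow> z s \<le> w (F s) i / u i)"
  proof (intro ball_cong refl)
    fix s assume s: "s \<in> {i..t}"
    show "ereal (u i) \<le> T s \<longleftrightarrow> (m < s \<longrightarrow> z s \<le> w (F s) i / u i)"
    proof (cases "m < s")
      case True
      then show ?thesis using le_ereal_divide_iff[OF w_pos ui z_pos[of s]] s tN by auto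
    next
      case False
      \<comment> \<open>Up to time \<open>m\<close> the threshold is 0 and the ratio infinite, so
        these times impose no condition.\<close>
      have "ereal (w (F s) i) / 0 = \<infinity>" using w_pos[of "F s" i] by (simp add: divide_ereal_def)
      with False show ?thesis by (simp flip: zero_ereal_def)
    qed
  qed
  finally show ?thesis .
qed

text \<open>If \<open>i\<close> survives, each discarded edge is a competitor with smaller priority,
  which bounds \<open>z s\<close>. If not, at the first time when \<open>i\<close> is missing the
  histories still agree and \<open>i\<close> lies strictly below all competitors, so the condition
  of \<open>le_cap_iff\<close> fails there.\<close>

lemma survives_iff:
  assumes "u i \<le> 1"
  shows "i \<in> K t \<omega> \<longleftrightarrow> u i \<le> ratio_cap m w F b {i} i t"
proof (cases "i \<in> K t \<omega>")
  case True
  have "z s \<le> w (F s) i / u i" if s: "s \<in> {i..t}" "m < s" for s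
  proof -
    have surv: "i \<in> K s' \<omega>" if "i \<le> s'" "s' \<le> s" for s'
      using K_antimono[OF i _ _ tN True, of s'] that s by auto
    have F: "F s = H s" using surv s tN by (intro forced_history_eq b) auto
    obtain j where j: "j \<in> P s" "K s \<omega> = P s - {j}" "\<And>k. k \<in> P s - {j} \<Longrightarrow> r s j < r s k"
      using K_discard[of s] s tN i by auto
    have iK: "i \<in> K s \<omega>" using surv[of s] s by simp
    have s': "1 \<le> s" "s \<le> N" using s i tN by auto
    have bj: "b j = u j" using P_bound[OF s'] j iK s' by (intro b) auto
    have "z s \<le> w (F s) j / b j"
      using j iK finite_P[OF s'] s' by (intro Min_le) (auto simp: F last_sample_history)
    also have "\<dots> \<le> w (F s) i / u i" using j(3)[of i] iK j(2) bj by (simp add: F)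
    finally show ?thesis .
  qed
  then show ?thesis using le_cap_iff[OF assms] True by blast
next
  case False
  define s where "s = (LEAST s. i \<le> s \<and> i \<notin> K s \<omega>)"
  have s: "i \<le> s" "i \<notin> K s \<omega>" unfolding s_def using LeastI[of "\<lambda>s. i \<le> s \<and> i \<notin> K s \<omega>" t] False it by auto
  have st: "s \<le> t" unfolding s_def using False it by (intro Least_le) auto
  have surv: "i \<in> K s' \<omega>" if "i \<le> s'" "s' < s" for s'
    using not_less_Least[of s' "\<lambda>s. i \<le> s \<and> i \<notin> K s \<omega>"] that unfolding s_def by auto
  have s': "1 \<le> s" "s \<le> N" using s st i tN by auto
  have F: "F s = H s" using surv s' by (intro forced_history_eq b) auto
  have ms: "m < s" using K_full[of s] s s' i by (cases "m < s") auto
  have iP: "i \<in> P s" using surv[of "s - 1"] s s' by (cases "s = i") (auto simp: provisional_sample_def)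
  have j: "r s i < r s k" if "k \<in> P s - {i}" for k
    using K_discard[of s] s s' ms iP that by auto
  have "w (F s) i / u i < z s"
  proof (subst Min_gr_iff)
    show "\<forall>a\<in>(\<lambda>j. w (F s) j / b j) ` (last (F s) - {i}). w (F s) i / u i < a"
    proof (intro ballI, elim imageE)
      fix a k assume a: "a = w (F s) k / b k" and k: "k \<in> last (F s) - {i}"
      then have kP: "k \<in> P s - {i}" using s' by (simp add: F last_sample_history)
      then have "b k = u k" using P_bound[OF s'] s' by (intro b) auto
      then show "w (F s) i / u i < a" using j[OF kP] by (simp add: F a)
    qed
  qed (use forced_nonempty[of s] s s' ms finite_P in \<open>auto simp: F last_sample_history\<close>)
  then show ?thesis using le_cap_iff[OF assms] False s st ms by force
qed

text \<open>While \<open>i\<close> survives, the minimal priority is attained at a discarded edge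
  other than \<open>i\<close>, so removing \<open>i\<close> from the minimum leaves each threshold
  unchanged.\<close>

lemma cap_eq:
  assumes "i \<in> K t \<omega>"
  shows "ratio_cap m w H u {} i t = ratio_cap m w F b {i} i t"
proof -
  have "(if s \<le> m then 0 else Min ((\<lambda>j. w (H s) j / u j) ` (last (H s) - {}))) = (if s \<le> m then 0 else z s)"
    and "F s = H s"
    if s: "s \<in> {i..t}" for s
  proof -
    have surv: "i \<in> K s' \<omega>" if "i \<le> s'" "s' \<le> s" for s'
      using K_antimono[OF i _ _ tN assms, of s'] that s by auto
    show F: "F s = H s" using surv s tN by (intro forced_history_eq b) auto
    have s': "1 \<le> s" "s \<le> N" using s i tN by auto
    show "(if s \<le> m then 0 else Min ((\<lambda>j. w (H s) j / u j) ` (last (H s) - {}))) = (if s \<le> m then 0 else z s)"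
    proof (cases "s \<le> m")
      case False
      obtain j where j: "j \<in> P s" "K s \<omega> = P s - {j}" "\<And>k. k \<in> P s - {j} \<Longrightarrow> r s j < r s k"
        using K_discard[of s] False s' by auto
      have iK: "i \<in> K s \<omega>" using surv[of s] s by simp
      have bk: "b k = u k" if "k \<in> P s - {i}" for k using P_bound[OF s'] s' that by (intro b) auto
      have le: "r s j \<le> r s k" if "k \<in> P s" for k using j(3)[of k] that by (cases "k = j") auto
      have "Min (r s ` P s) = r s j"
        using j(1) le finite_P[OF s'] by (intro Min_eqI) auto
      moreover have "z s = Min (r s ` (P s - {i}))"
        using bk s' by (auto simp: F last_sample_history intro!: arg_cong[where f = Min] image_cong)
      moreover have "Min (r s ` (P s - {i})) = r s j"
        using j(1,2) iK le finite_P[OF s'] by (intro Min_eqI) auto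
      ultimately show ?thesis using False s' by (simp add: last_sample_history)
    qed simp
  qed
  then have "(INF s\<in>{i..t}. ereal (w (H s) i) /
      ereal (if s \<le> m then 0 else Min ((\<lambda>j. w (H s) j / u j) ` (last (H s) - {})))) = (INF s\<in>{i..t}. T s)"
    by (intro INF_cong refl) simp
  then show ?thesis unfolding ratio_cap_def by simp
qed

end

end

subsection \<open>Uniform and atomless random variables\<close>

text \<open>The probability \<open>y\<close> of \<open>{0<..y}\<close> cancels the weight
  \<open>1 / y\<close>; \<open>y \<le> 1\<close> guarantees that the interval is not cut off at
  1.\<close>

lemma nn_integral_uniform_indicator_div:
  fixes y :: real
  assumes "0 < y" "y \<le> 1"
  shows "(\<integral>\<^sup>+x. ennreal (indicator {..y} x / y) \<partial>uniform_measure lborel {0<..1}) = 1"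
proof -
  have "(\<integral>\<^sup>+x. ennreal (indicator {..y} x / y) \<partial>uniform_measure lborel {0<..1}) =
      (\<integral>\<^sup>+x. ennreal (1 / y) * indicator {..y} x \<partial>uniform_measure lborel {0<..1})"
    by (intro nn_integral_cong) (auto simp: indicator_def)
  also have "\<dots> = ennreal (1 / y) * emeasure (uniform_measure lborel {0<..1}) {..y}"
    by (simp add: nn_integral_cmult_indicator)
  also have "{0<..1} \<inter> {..y} = {0<..y}" using assms by auto
  then have "emeasure (uniform_measure lborel {0<..1}) {..y} = ennreal y"
    using assms by (simp add: divide_ennreal flip: ennreal_1)
  also have "ennreal (1 / y) * ennreal y = 1"
    using assms by (simp flip: ennreal_mult)
  finally show ?thesis .
qed

context prob_space
begin

text \<open>By independence the joint law is a product, and Tonelli allows integrating over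
  \<open>X\<close> first, which gives 1 for almost every value of \<open>Q\<close>. Working with the
  nonnegative integral yields integrability as well.\<close>

lemma indep_uniform_indicator_div:
  fixes X Q :: "'a \<Rightarrow> real"
  assumes indep: "indep_var borel X borel Q"
    and X: "distr M borel X = uniform_measure lborel {0<..1}"
    and Q: "AE \<omega> in M. 0 < Q \<omega> \<and> Q \<omega> \<le> 1"
  shows "has_bochner_integral M (\<lambda>\<omega>. indicator {..Q \<omega>} (X \<omega>) / Q \<omega>) 1"
proof (rule has_bochner_integral_nn_integral)
  have [measurable]: "X \<in> borel_measurable M" "Q \<in> borel_measurable M"
    using indep by (auto dest: indep_var_rv1 indep_var_rv2)
  \<comment> \<open>The set \<open>{..Q \<omega>}\<close> varies with the outcome; as a comparison
    of two random variables the indicator is visibly measurable.\<close>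
  have eq: "indicator {..Q \<omega>} (X \<omega>) = (if X \<omega> \<le> Q \<omega> then 1 else 0 :: real)" for \<omega>
    by (simp add: indicator_def)
  show "(\<lambda>\<omega>. indicator {..Q \<omega>} (X \<omega>) / Q \<omega>) \<in> borel_measurable M"
    unfolding eq by measurable
  show "AE \<omega> in M. 0 \<le> indicator {..Q \<omega>} (X \<omega>) / Q \<omega>"
    using Q by eventually_elim simp
  interpret X: prob_space "distr M borel X" by (rule prob_space_distr) simp
  interpret Q: prob_space "distr M borel Q" by (rule prob_space_distr) simp
  interpret pair_sigma_finite "distr M borel X" "distr M borel Q" ..
  let ?g = "\<lambda>(x, y). ennreal ((if x \<le> y then 1 else 0) / y)"
  have [measurable]: "?g \<in> borel_measurable (borel \<Otimes>\<^sub>M borel)" by measurable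
  have "(\<integral>\<^sup>+\<omega>. ennreal (indicator {..Q \<omega>} (X \<omega>) / Q \<omega>) \<partial>M) =
      (\<integral>\<^sup>+p. ?g p \<partial>distr M (borel \<Otimes>\<^sub>M borel) (\<lambda>\<omega>. (X \<omega>, Q \<omega>)))"
    by (subst nn_integral_distr) (auto simp: eq)
  also have "\<dots> = (\<integral>\<^sup>+p. ?g p \<partial>(distr M borel X \<Otimes>\<^sub>M distr M borel Q))"
    using indep unfolding indep_var_distribution_eq by simp
  also have "\<dots> = (\<integral>\<^sup>+y. (\<integral>\<^sup>+x. ?g (x, y) \<partial>distr M borel X) \<partial>distr M borel Q)"
    by (rule nn_integral_snd[symmetric]) simp
  also have "\<dots> = (\<integral>\<^sup>+y. 1 \<partial>distr M borel Q)"
  proof (rule nn_integral_cong_AE)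
    have "AE y in distr M borel Q. 0 < y \<and> y \<le> 1" using Q by (subst AE_distr_iff) auto
    then show "AE y in distr M borel Q. (\<integral>\<^sup>+x. ?g (x, y) \<partial>distr M borel X) = 1"
    proof eventually_elim
      case (elim y)
      have "(\<integral>\<^sup>+x. ?g (x, y) \<partial>distr M borel X) = (\<integral>\<^sup>+x. ennreal (indicator {..y} x / y) \<partial>distr M borel X)"
        by (intro nn_integral_cong) (simp add: indicator_def)
      then show ?case using nn_integral_uniform_indicator_div[of y] elim by (simp add: X)
    qed
  qed
  also have "\<dots> = ennreal 1" using Q.emeasure_space_1 by simp
  finally show "(\<integral>\<^sup>+\<omega>. ennreal (indicator {..Q \<omega>} (X \<omega>) / Q \<omega>) \<partial>M) = ennreal 1" .
qed simp

text \<open>The diagonal is null for the product law: each of its sections at a fixed value of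
  \<open>X\<close> is a single point, which the law of \<open>Y\<close> does not charge.\<close>

lemma AE_indep_neq:
  fixes X Y :: "'a \<Rightarrow> real"
  assumes indep: "indep_var borel X borel Y"
    and atomless: "\<And>y. emeasure (distr M borel Y) {y} = 0"
  shows "AE \<omega> in M. X \<omega> \<noteq> Y \<omega>"
proof -
  have [measurable]: "X \<in> borel_measurable M" "Y \<in> borel_measurable M"
    using indep by (auto dest: indep_var_rv1 indep_var_rv2)
  interpret Y: prob_space "distr M borel Y" by (rule prob_space_distr) simp
  interpret X: prob_space "distr M borel X" by (rule prob_space_distr) simp
  interpret pair_sigma_finite "distr M borel X" "distr M borel Y" ..
  have neq: "AE y in distr M borel Y. x \<noteq> y" for x
    by (rule AE_I[of _ _ "{x}"]) (auto simp: atomless)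
  have "AE p in distr M borel X \<Otimes>\<^sub>M distr M borel Y. fst p \<noteq> snd p"
  proof (rule AE_pair_measure)
    have "{p \<in> space (borel \<Otimes>\<^sub>M borel). fst p \<noteq> (snd p :: real)} \<in> sets (borel \<Otimes>\<^sub>M borel)"
      by measurable
    then show "{p \<in> space (distr M borel X \<Otimes>\<^sub>M distr M borel Y). fst p \<noteq> snd p}
        \<in> sets (distr M borel X \<Otimes>\<^sub>M distr M borel Y)"
      by (simp add: space_pair_measure)
  qed (simp add: neq)
  then have "AE p in distr M (borel \<Otimes>\<^sub>M borel) (\<lambda>\<omega>. (X \<omega>, Y \<omega>)). fst p \<noteq> snd p"
    using indep unfolding indep_var_distribution_eq by (simp only:)
  then show ?thesis by (subst (asm) AE_distr_iff) simp_all
qed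

end

subsection \<open>Measurability\<close>

text \<open>A finite set of possible histories: measurability of anything computed from a random
  history reduces to the case of each fixed history.\<close>

definition histories :: "nat \<Rightarrow> nat \<Rightarrow> nat set list set" where
  "histories N t = {h. set h \<subseteq> Pow {1..N} \<and> length h = t}"

lemma finite_histories [simp]: "finite (histories N t)"
  unfolding histories_def by (rule finite_lists_length_eq) simp

lemma last_histories: "h \<in> histories N t \<Longrightarrow> 1 \<le> t \<Longrightarrow> last h \<subseteq> {1..N}"
  by (cases h rule: rev_cases) (auto simp: histories_def)

text \<open>For a fixed history the ratio is built from a minimum of finitely many measurable
  quotients. With \<open>X = {i}\<close> only coordinates other than \<open>i\<close> occur, so the
  cap is measurable on their product space. \<open>1 \<le> i\<close> keeps the histories nonempty,
  so that \<open>last\<close> is meaningful.\<close>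

lemma measurable_ratio_cap:
  assumes H: "\<And>s. s \<in> {i..t} \<Longrightarrow> (\<lambda>x. H x s) \<in> A \<rightarrow>\<^sub>M count_space (histories N s)"
    and u: "\<And>j. j \<in> {1..N} - X \<Longrightarrow> (\<lambda>x. u x j) \<in> borel_measurable A"
    and i: "1 \<le> i"
  shows "(\<lambda>x. ratio_cap m w (H x) (u x) X i t) \<in> borel_measurable A"
proof -
  have "(\<lambda>x. ereal (w (H x s) i) /
       ereal (if s \<le> m then 0 else Min ((\<lambda>j. w (H x s) j / u x j) ` (last (H x s) - X)))) \<in> borel_measurable A"
    if s: "s \<in> {i..t}" for s
  proof (rule measurable_compose_countable'[OF _ H[OF s], where
      f = "\<lambda>h x. ereal (w h i) / ereal (if s \<le> m then 0 else Min ((\<lambda>j. w h j / u x j) ` (last h - X)))"])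
    fix h assume h: "h \<in> histories N s"
    then have sub: "last h - X \<subseteq> {1..N} - X" using last_histories[OF h] s i by auto
    then have fin: "finite (last h - X)" using finite_subset by blast
    have "(\<lambda>x. Min ((\<lambda>j. w h j / u x j) ` (last h - X))) \<in> borel_measurable A"
      using sub u by (intro borel_measurable_Min fin borel_measurable_divide) auto
    then show "(\<lambda>x. ereal (w h i) / ereal (if s \<le> m then 0 else Min ((\<lambda>j. w h j / u x j) ` (last h - X))))
        \<in> borel_measurable A"
      by measurable
  qed (simp add: countable_finite)
  then show ?thesis unfolding ratio_cap_def
    by (intro borel_measurable_real_of_ereal borel_measurable_min borel_measurable_INF) auto
qed

text \<open>Each step splits over the finitely many previous histories; for a fixed one the kept set
  is determined by finitely many comparisons of priorities.\<close>

lemma measurable_forced_history: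
  assumes u: "\<And>j. j \<in> {1..N} - {i} \<Longrightarrow> (\<lambda>x. u x j) \<in> borel_measurable A"
  shows "t \<le> N \<Longrightarrow> (\<lambda>x. forced_history m w i (u x) t) \<in> A \<rightarrow>\<^sub>M count_space (histories N t)"
proof (induction t)
  case 0
  then show ?case by (simp add: histories_def)
next
  case (Suc t)
  have IH: "(\<lambda>x. forced_history m w i (u x) t) \<in> A \<rightarrow>\<^sub>M count_space (histories N t)"
    using Suc by simp
  have "(\<lambda>x. h @ [insert (Suc t) (forced_kept m w i (u x) h)]) \<in> A \<rightarrow>\<^sub>M count_space (histories N (Suc t))"
    if h: "h \<in> histories N t" for h
  proof -
    have "forced_kept m w i (u x) h \<in> Pow {1..N}" for x
      using last_histories[OF h] h Suc.prems
      by (cases "t = 0") (auto simp: forced_kept_def histories_def)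
    moreover have "(\<lambda>x. forced_kept m w i (u x) h) -` {S} \<inter> space A \<in> sets A" for S
    proof (cases "t \<le> m")
      case True
      then show ?thesis using h by (auto simp: forced_kept_def histories_def)
    next
      case False
      then have sub: "last h \<subseteq> {1..N}" using last_histories[OF h] by auto
      then have "finite (last h)" using finite_subset by blast
      have [measurable]: "Measurable.pred A (\<lambda>x. w h k / u x k < w h j / u x j)"
        if "k \<in> last h - {i}" "j \<in> last h - {i}" for k j
      proof -
        have [measurable]: "(\<lambda>x. u x k) \<in> borel_measurable A" "(\<lambda>x. u x j) \<in> borel_measurable A"
          using that sub u by auto
        show ?thesis by measurable
      qed
      \<comment> \<open>For \<open>j = i\<close> the predicate is constantly true, so the coordinate
        \<open>i\<close> does not enter.\<close>
      have pred: "Measurable.pred A (\<lambda>x. j = i \<or> (\<exists>k\<in>last h - {i}. w h k / u x k < w h j / u x j))"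
        if "j \<in> last h" for j
        using that \<open>finite (last h)\<close>
        by (cases "j = i") (auto intro!: pred_intros_finite)
      \<comment> \<open>Equality with a given set becomes a finite conjunction of membership
        conditions, one for each edge of \<open>last h\<close>.\<close>
      have eq: "forced_kept m w i (u x) h = S \<longleftrightarrow> S \<subseteq> last h \<and>
          (\<forall>j\<in>last h. (j = i \<or> (\<exists>k\<in>last h - {i}. w h k / u x k < w h j / u x j)) \<longleftrightarrow> j \<in> S)" for x
        using False h by (auto simp: forced_kept_def histories_def)
      have "Measurable.pred A (\<lambda>x. S \<subseteq> last h \<and>
          (\<forall>j\<in>last h. (j = i \<or> (\<exists>k\<in>last h - {i}. w h k / u x k < w h j / u x j)) \<longleftrightarrow> j \<in> S))"
        using \<open>finite (last h)\<close>
        by (intro pred_intros_logic(3,6) pred_intros_finite pred) simp_all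
      then have "{x \<in> space A. forced_kept m w i (u x) h = S} \<in> sets A"
        unfolding pred_def eq .
      moreover have "(\<lambda>x. forced_kept m w i (u x) h) -` {S} \<inter> space A =
          {x \<in> space A. forced_kept m w i (u x) h = S}"
        by blast
      ultimately show ?thesis by simp
    qed
    ultimately have "(\<lambda>x. forced_kept m w i (u x) h) \<in> A \<rightarrow>\<^sub>M count_space (Pow {1..N})"
      by (subst measurable_count_space_eq2) auto
    then show ?thesis
      by (rule measurable_compose) (use h Suc.prems in \<open>auto simp: histories_def\<close>)
  qed
  from measurable_compose_countable'[OF this IH] show ?case
    by (simp add: countable_finite)
qed

subsection \<open>The sampling scheme\<close>

text \<open>
  Weights are only known to be positive on the histories that occur, whereas the forced scheme may
  reach other ones.
\<close>

definition positive_weight ::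
  "(nat set list \<Rightarrow> nat \<Rightarrow> real) \<Rightarrow> nat set list \<Rightarrow> nat \<Rightarrow> real" where
  "positive_weight w h j = (if w h j > 0 then w h j else 1)"

lemma inclusion_prob_eq_ratio_cap:
  assumes "1 \<le> i"
  shows "inclusion_prob m es W \<beta> K i t \<omega> =
    ratio_cap m (W es) (\<lambda>s. sample_history K s \<omega>) (\<lambda>j. \<beta> j \<omega>) {} i t"
proof -
  have "(INF s\<in>{i..t}. ereal (weight es W K i s \<omega>) / ereal (threshold m es W \<beta> K s \<omega>)) =
      (INF s\<in>{i..t}. ereal (W es (sample_history K s \<omega>) i) / ereal (if s \<le> m then 0
        else Min ((\<lambda>j. W es (sample_history K s \<omega>) j / \<beta> j \<omega>) ` (last (sample_history K s \<omega>) - {}))))"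
    using assms
    by (intro INF_cong refl) (simp add: weight_def threshold_def priority_def last_sample_history)
  then show ?thesis by (simp only: inclusion_prob_def ratio_cap_def)
qed

text \<open>Serves to exchange the weight rule for its positive variant along the actual history;
  \<open>insert i\<close> accounts for the numerator.\<close>

lemma ratio_cap_weight_cong:
  assumes "\<And>s j. s \<in> {i..t} \<Longrightarrow> j \<in> insert i (last (H s)) \<Longrightarrow> w (H s) j = w' (H s) j"
  shows "ratio_cap m w H u X i t = ratio_cap m w' H u X i t"
proof -
  have "(INF s\<in>{i..t}. ereal (w (H s) i) / ereal (if s \<le> m then 0
          else Min ((\<lambda>j. w (H s) j / u j) ` (last (H s) - X)))) =
      (INF s\<in>{i..t}. ereal (w' (H s) i) / ereal (if s \<le> m then 0
          else Min ((\<lambda>j. w' (H s) j / u j) ` (last (H s) - X))))"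
  proof (intro INF_cong refl)
    fix s assume s: "s \<in> {i..t}"
    then have "(\<lambda>j. w (H s) j / u j) ` (last (H s) - X) = (\<lambda>j. w' (H s) j / u j) ` (last (H s) - X)"
      using assms by (intro image_cong) auto
    then show "ereal (w (H s) i) / ereal (if s \<le> m then 0
          else Min ((\<lambda>j. w (H s) j / u j) ` (last (H s) - X))) =
        ereal (w' (H s) i) / ereal (if s \<le> m then 0
          else Min ((\<lambda>j. w' (H s) j / u j) ` (last (H s) - X)))"
      using assms[OF s, of i] by simp
  qed
  then show ?thesis by (simp only: ratio_cap_def)
qed

lemma sampling_step:
  assumes "adaptive_priority_sampling M m es W \<beta> K" "\<omega> \<in> space M"
  shows "K 0 \<omega> = {}"
    and "t \<in> {1..length es} \<Longrightarrow> i \<in> provisional_sample K t \<omega> \<Longrightarrow> W es (sample_history K t \<omega>) i > 0"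
    and "t \<in> {1..length es} \<Longrightarrow> t \<le> m \<Longrightarrow> K t \<omega> = provisional_sample K t \<omega>"
    and "t \<in> {1..length es} \<Longrightarrow> m < t \<Longrightarrow> \<exists>j\<in>provisional_sample K t \<omega>.
      priority es W \<beta> K j t \<omega> = Min ((\<lambda>j. priority es W \<beta> K j t \<omega>) ` provisional_sample K t \<omega>) \<and>
      K t \<omega> = provisional_sample K t \<omega> - {j}"
proof -
  show "K 0 \<omega> = {}"
    using assms by (auto simp: adaptive_priority_sampling_def)
  have step: "(\<forall>i\<in>provisional_sample K t \<omega>. weight es W K i t \<omega> > 0) \<and>
      (if t \<le> m then K t \<omega> = provisional_sample K t \<omega>
       else \<exists>j\<in>provisional_sample K t \<omega>.
              priority es W \<beta> K j t \<omega> = threshold m es W \<beta> K t \<omega> \<and>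
              K t \<omega> = provisional_sample K t \<omega> - {j})" if "t \<in> {1..length es}"
    using assms that unfolding adaptive_priority_sampling_def by blast
  show "W es (sample_history K t \<omega>) i > 0"
    if "t \<in> {1..length es}" "i \<in> provisional_sample K t \<omega>"
    using step that by (simp add: weight_def)
  show "K t \<omega> = provisional_sample K t \<omega>" if "t \<in> {1..length es}" "t \<le> m"
    using step that by simp
  show "\<exists>j\<in>provisional_sample K t \<omega>.
      priority es W \<beta> K j t \<omega> = Min ((\<lambda>j. priority es W \<beta> K j t \<omega>) ` provisional_sample K t \<omega>) \<and>
      K t \<omega> = provisional_sample K t \<omega> - {j}" if "t \<in> {1..length es}" "m < t"
    using step that by (simp add: threshold_def)
qed

lemma sample_subset:
  assumes "adaptive_priority_sampling M m es W \<beta> K" "\<omega> \<in> space M"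
  shows "t \<le> length es \<Longrightarrow> K t \<omega> \<subseteq> {1..t}"
proof (induction t)
  case 0
  then show ?case using sampling_step(1)[OF assms] by simp
next
  case (Suc t)
  then have "provisional_sample K (Suc t) \<omega> \<subseteq> {1..Suc t}"
    by (fastforce simp: provisional_sample_def)
  moreover have "K (Suc t) \<omega> \<subseteq> provisional_sample K (Suc t) \<omega>"
    using sampling_step(3,4)[OF assms, of "Suc t"] Suc.prems by (cases "Suc t \<le> m") fastforce+
  ultimately show ?case by blast
qed

section \<open>Measurability of the actual samples and of the estimator\<close>

lemma measurable_sample:
  assumes "adaptive_priority_sampling M m es W \<beta> K" "t \<le> length es"
  shows "K t \<in> M \<rightarrow>\<^sub>M count_space (Pow {1..length es})"
proof (cases "t = 0")
  case True
  \<comment> \<open>The scheme postulates measurability from time 1 on; at time 0 the sample is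
    constantly empty.\<close>
  have "K 0 \<in> M \<rightarrow>\<^sub>M count_space (Pow {1..length es}) \<longleftrightarrow>
      (\<lambda>\<omega>. {}) \<in> M \<rightarrow>\<^sub>M count_space (Pow {1..length es})"
    using sampling_step(1)[OF assms(1)] by (intro measurable_cong)
  then show ?thesis using True by simp
next
  case False
  then have "K t \<in> M \<rightarrow>\<^sub>M count_space UNIV"
    using assms by (auto simp: adaptive_priority_sampling_def)
  then have "K t -` {S} \<inter> space M \<in> sets M" for S
    by (rule measurable_sets) simp
  moreover have "K t \<in> space M \<rightarrow> Pow {1..length es}"
    using sample_subset[OF assms(1) _ assms(2)] assms(2) by fastforce
  ultimately show ?thesis by (subst measurable_count_space_eq2) auto
qed

lemma measurable_sample_history:
  assumes "adaptive_priority_sampling M m es W \<beta> K"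
  shows "t \<le> length es \<Longrightarrow>
    (\<lambda>\<omega>. sample_history K t \<omega>) \<in> M \<rightarrow>\<^sub>M count_space (histories (length es) t)"
proof (induction t)
  case 0
  then show ?case by (simp add: sample_history_def histories_def)
next
  case (Suc t)
  have "(\<lambda>\<omega>. h @ [insert (Suc t) (K t \<omega>)]) \<in> M \<rightarrow>\<^sub>M count_space (histories (length es) (Suc t))"
    if "h \<in> histories (length es) t" for h
    using measurable_sample[OF assms, of t]
    by (rule measurable_compose) (use that Suc.prems in \<open>auto simp: histories_def\<close>)
  moreover have "(\<lambda>\<omega>. sample_history K t \<omega>) \<in> M \<rightarrow>\<^sub>M count_space (histories (length es) t)"
    using Suc by simp
  ultimately have "(\<lambda>\<omega>. sample_history K t \<omega> @ [insert (Suc t) (K t \<omega>)])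
      \<in> M \<rightarrow>\<^sub>M count_space (histories (length es) (Suc t))"
    by (rule measurable_compose_countable') (simp_all add: countable_finite)
  then show ?case by (simp add: sample_history_Suc provisional_sample_def)
qed

text \<open>The pathwise formula for the estimator holds only almost surely, and transferring the
  Bochner integral along it requires measurability of the estimator itself.\<close>

lemma measurable_edge_estimator:
  assumes K: "adaptive_priority_sampling M m es W \<beta> K"
    and \<beta>: "\<And>j. j \<in> {1..length es} \<Longrightarrow> \<beta> j \<in> borel_measurable M"
    and "1 \<le> i" "t \<le> length es"
  shows "edge_estimator m es W \<beta> K i t \<in> borel_measurable M"
proof -
  have "(\<lambda>\<omega>. inclusion_prob m es W \<beta> K i t \<omega>) \<in> borel_measurable M"
    unfolding inclusion_prob_eq_ratio_cap[OF assms(3)]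
    using assms by (intro measurable_ratio_cap[where N = "length es"] measurable_sample_history[OF K] \<beta>) auto
  moreover have "(\<lambda>\<omega>. indicator (K t \<omega>) i :: real) \<in> borel_measurable M"
    using measurable_sample[OF K assms(4)] by (rule measurable_compose) simp
  ultimately show ?thesis
    unfolding edge_estimator_def by (rule borel_measurable_divide[rotated])
qed

text \<open>Without ties a minimal priority is a strict minimum. Ties are excluded for every
  possible history, so that for each of them the weights are constants and only the variables
  \<open>\<beta> j\<close> are random.\<close>

lemma priority_sampled_pathI:
  assumes K: "adaptive_priority_sampling M m es W \<beta> K" and \<omega>: "\<omega> \<in> space M" and m: "m \<ge> 1"
    and pos: "\<And>j. j \<in> {1..length es} \<Longrightarrow> \<beta> j \<omega> > 0"
    and no_ties: "\<And>t h j k. t \<in> {1..length es} \<Longrightarrow> h \<in> histories (length es) t \<Longrightarrow>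
      j \<in> {1..length es} \<Longrightarrow> k \<in> {1..length es} \<Longrightarrow> j \<noteq> k \<Longrightarrow>
      positive_weight (W es) h j / \<beta> j \<omega> \<noteq> positive_weight (W es) h k / \<beta> k \<omega>"
  shows "priority_sampled_path (length es) m (positive_weight (W es)) (\<lambda>j. \<beta> j \<omega>) K \<omega>"
proof
  fix t assume t: "t \<in> {1..length es}" "m < t"
  let ?P = "provisional_sample K t \<omega>" and ?h = "sample_history K t \<omega>"
  have sub: "?P \<subseteq> {1..length es}"
    using sample_subset[OF K \<omega>, of "t - 1"] t by (fastforce simp: provisional_sample_def)
  then have fin: "finite ?P" using finite_subset by blast
  have h: "?h \<in> histories (length es) t"
    using measurable_space[OF measurable_sample_history[OF K, of t]] \<omega> t by simp
  have w: "priority es W \<beta> K k t \<omega> = positive_weight (W es) ?h k / \<beta> k \<omega>" if "k \<in> ?P" for k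
    using sampling_step(2)[OF K \<omega>] t that by (simp add: priority_def weight_def positive_weight_def)
  obtain j where j: "j \<in> ?P" "K t \<omega> = ?P - {j}"
    "priority es W \<beta> K j t \<omega> = Min ((\<lambda>j. priority es W \<beta> K j t \<omega>) ` ?P)"
    using sampling_step(4)[OF K \<omega> t] by blast
  have "positive_weight (W es) ?h j / \<beta> j \<omega> < positive_weight (W es) ?h k / \<beta> k \<omega>"
    if k: "k \<in> ?P - {j}" for k
  proof -
    have "priority es W \<beta> K j t \<omega> \<le> priority es W \<beta> K k t \<omega>"
      unfolding j(3) using k fin by (intro Min_le) auto
    moreover have "positive_weight (W es) ?h j / \<beta> j \<omega> \<noteq> positive_weight (W es) ?h k / \<beta> k \<omega>"
      using j(1) k sub by (intro no_ties[OF t(1) h]) auto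
    ultimately show ?thesis using w[of j] w[of k] j(1) k by simp
  qed
  with j show "\<exists>j\<in>?P. K t \<omega> = ?P - {j} \<and> (\<forall>k\<in>?P - {j}.
      positive_weight (W es) ?h j / \<beta> j \<omega> < positive_weight (W es) ?h k / \<beta> k \<omega>)"
    by blast
qed (use m pos sampling_step(1,3)[OF K \<omega>] in \<open>auto simp: positive_weight_def\<close>)

text \<open>Distinct reciprocals give distinct priorities, and the reciprocals are rescaled
  independent variables, the second of them atomless.\<close>

lemma (in prob_space) AE_no_ties:
  fixes \<beta> :: "nat \<Rightarrow> 'a \<Rightarrow> real"
  assumes indep: "indep_vars (\<lambda>_. borel) \<beta> J" and j: "j \<in> J" and k: "k \<in> J" and neq: "j \<noteq> k"
    and atomless: "\<And>x. emeasure (distr M borel (\<beta> k)) {x} = 0"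
    and c: "0 < b"
  shows "AE \<omega> in M. a / \<beta> j \<omega> \<noteq> b / \<beta> k \<omega>"
proof -
  have [measurable]: "\<beta> j \<in> borel_measurable M" "\<beta> k \<in> borel_measurable M"
    using indep j k by (auto simp: indep_vars_def)
  have "indep_var (PiM {j} (\<lambda>_. borel)) (\<lambda>\<omega>. restrict (\<lambda>i. \<beta> i \<omega>) {j})
      (PiM {k} (\<lambda>_. borel)) (\<lambda>\<omega>. restrict (\<lambda>i. \<beta> i \<omega>) {k})"
    using j k neq by (intro indep_var_restrict[OF indep]) auto
  then have "indep_var borel ((\<lambda>f. f j / a) \<circ> (\<lambda>\<omega>. restrict (\<lambda>i. \<beta> i \<omega>) {j}))
      borel ((\<lambda>f. f k / b) \<circ> (\<lambda>\<omega>. restrict (\<lambda>i. \<beta> i \<omega>) {k}))"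
    by (rule indep_var_compose) simp_all
  then have "indep_var borel (\<lambda>\<omega>. \<beta> j \<omega> / a) borel (\<lambda>\<omega>. \<beta> k \<omega> / b)"
    by (simp add: comp_def)
  moreover have "emeasure (distr M borel (\<lambda>\<omega>. \<beta> k \<omega> / b)) {y} = 0" for y
  proof -
    have "(\<lambda>\<omega>. \<beta> k \<omega> / b) -` {y} \<inter> space M = \<beta> k -` {y * b} \<inter> space M"
      using c by (auto simp: field_simps)
    then show ?thesis using atomless[of "y * b"] by (simp add: emeasure_distr)
  qed
  ultimately have "AE \<omega> in M. \<beta> j \<omega> / a \<noteq> \<beta> k \<omega> / b"
    by (rule AE_indep_neq)
  then show ?thesis
    \<comment> \<open>Inversion is injective even at 0, where \<open>inverse 0 = 0\<close>.\<close>
    by eventually_elim (metis inverse_divide inverse_inverse_eq)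
qed

lemma emeasure_uniform_singleton:
  "emeasure (uniform_measure lborel {0<..1::real}) {x} = 0"
proof -
  have "emeasure lborel ({0<..1} \<inter> {x}) \<le> emeasure lborel {x}" by (rule emeasure_mono) auto
  then show ?thesis by simp
qed

section \<open>Unbiasedness of the edge estimator\<close>

theorem theorem1:
  fixes M :: "'a measure"
    and m :: nat
    and L R :: "'v set"
    and es :: "('v \<times> 'v) list"
    and W :: "('v \<times> 'v) list \<Rightarrow> nat set list \<Rightarrow> nat \<Rightarrow> real"
    and \<beta> :: "nat \<Rightarrow> 'a \<Rightarrow> real"
    and K :: "nat \<Rightarrow> 'a \<Rightarrow> nat set"
  assumes "m \<ge> 1"
    and "L \<inter> R = {}" and "set es \<subseteq> L \<times> R" and "distinct es"
    and "prob_space M"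
    and "prob_space.indep_vars M (\<lambda>_. borel) \<beta> {1..length es}"
    and "\<forall>i\<in>{1..length es}. distr M borel (\<beta> i) = uniform_measure lborel {0<..1}"
    and "adaptive_priority_sampling M m es W \<beta> K"
  shows "\<forall>i\<in>{1..length es}. \<forall>t\<in>{1..length es}.
           unbiased_estimator M (edge_estimator m es W \<beta> K i t) (edge_indicator i t)"
proof (intro ballI)
  fix i t assume i: "i \<in> {1..length es}" and t: "t \<in> {1..length es}"
  interpret prob_space M by fact
  note indep = assms(6) and unif = assms(7)[rule_format] and K = assms(8)
  define N where "N = length es"
  define w where "w = positive_weight (W es)"
  have \<beta>_meas: "\<beta> j \<in> borel_measurable M" if "j \<in> {1..N}" for j
    using indep that by (auto simp: indep_vars_def N_def)
  have est_meas: "edge_estimator m es W \<beta> K i t \<in> borel_measurable M"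
    using i t by (intro measurable_edge_estimator[OF K \<beta>_meas]) (auto simp: N_def)
  show "unbiased_estimator M (edge_estimator m es W \<beta> K i t) (edge_indicator i t)"
  proof (cases "i \<le> t")
    case False
    have "edge_estimator m es W \<beta> K i t \<omega> = 0" if "\<omega> \<in> space M" for \<omega>
    proof -
      have "i \<notin> K t \<omega>" using sample_subset[OF K that, of t] t False by auto
      then show ?thesis by (simp add: edge_estimator_def)
    qed
    then have "has_bochner_integral M (edge_estimator m es W \<beta> K i t) 0"
      by (subst has_bochner_integral_cong[OF refl _ refl, where g = "\<lambda>_. 0"]) auto
    then show ?thesis using False
      by (simp add: unbiased_estimator_def edge_indicator_def has_bochner_integral_iff)
  next
    case True
    define J where "J = {1..N} - {i}"
    \<comment> \<open>At \<open>i\<close> the restriction is \<open>undefined\<close>, so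
      \<open>Q (b \<omega>)\<close> carries no information from \<open>\<beta> i\<close> and is
      independent of it.\<close>
    define b where "b = (\<lambda>\<omega>. restrict (\<lambda>j. \<beta> j \<omega>) J)"
    define Q where "Q = (\<lambda>f. ratio_cap m w (forced_history m w i f) f {i} i t)"
    have "Q \<in> borel_measurable (PiM J (\<lambda>_. borel))"
      unfolding Q_def using i t
      by (intro measurable_ratio_cap[where N = N] measurable_forced_history) (auto simp: J_def N_def)
    moreover have "indep_var (PiM {i} (\<lambda>_. borel)) (\<lambda>\<omega>. restrict (\<lambda>j. \<beta> j \<omega>) {i})
        (PiM J (\<lambda>_. borel)) b"
      unfolding b_def using i by (intro indep_var_restrict[OF indep]) (auto simp: J_def N_def)
    ultimately have "indep_var borel ((\<lambda>f. f i) \<circ> (\<lambda>\<omega>. restrict (\<lambda>j. \<beta> j \<omega>) {i})) borel (Q \<circ> b)"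
      by (intro indep_var_compose) auto
    then have indep_Q: "indep_var borel (\<beta> i) borel (\<lambda>\<omega>. Q (b \<omega>))"
      by (simp add: comp_def)
    have "AE \<omega> in M. \<beta> j \<omega> \<in> {0<..1}" if "j \<in> {1..N}" for j
    proof -
      have "AE x in distr M borel (\<beta> j). x \<in> {0<..1}"
        unfolding unif[OF that[unfolded N_def]] by (rule AE_uniform_measureI) auto
      then show ?thesis using \<beta>_meas[OF that] by (subst (asm) AE_distr_iff) auto
    qed
    then have range: "AE \<omega> in M. \<forall>j\<in>{1..N}. \<beta> j \<omega> \<in> {0<..1}"
      by (simp add: AE_ball_countable)
    have "AE \<omega> in M. w h j / \<beta> j \<omega> \<noteq> w h k / \<beta> k \<omega>"
      if "j \<in> {1..N}" "k \<in> {1..N}" "j \<noteq> k" for h j k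
      using that unif[of k] emeasure_uniform_singleton
      by (intro AE_no_ties[OF indep]) (auto simp: N_def w_def positive_weight_def)
    \<comment> \<open>The history is random but takes values in a finite set, so finitely many null
      sets cover all ties.\<close>
    then have ties: "AE \<omega> in M. \<forall>s\<in>{1..N}. \<forall>h\<in>histories N s. \<forall>j\<in>{1..N}. \<forall>k\<in>{1..N} - {j}.
        w h j / \<beta> j \<omega> \<noteq> w h k / \<beta> k \<omega>"
      by (simp add: AE_ball_countable countable_finite)
    have main: "AE \<omega> in M. 0 < Q (b \<omega>) \<and> Q (b \<omega>) \<le> 1 \<and>
        edge_estimator m es W \<beta> K i t \<omega> = indicator {..Q (b \<omega>)} (\<beta> i \<omega>) / Q (b \<omega>)"
      using range ties AE_space
    proof eventually_elim
      case (elim \<omega>)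
      interpret priority_sampled_path N m w "\<lambda>j. \<beta> j \<omega>" K \<omega>
        unfolding N_def w_def using elim \<open>m \<ge> 1\<close>
        by (intro priority_sampled_pathI[OF K]) (auto simp: N_def w_def)
      have prems: "1 \<le> i" "i \<le> t" "t \<le> N" "\<And>j. j \<in> {1..N} - {i} \<Longrightarrow> b \<omega> j = \<beta> j \<omega>"
        using i t True by (auto simp: N_def b_def J_def)
      have surv: "i \<in> K t \<omega> \<longleftrightarrow> \<beta> i \<omega> \<le> Q (b \<omega>)"
        unfolding Q_def using elim(1) i by (intro survives_iff[OF prems]) (auto simp: N_def)
      have "inclusion_prob m es W \<beta> K i t \<omega> = Q (b \<omega>)" if iK: "i \<in> K t \<omega>"
      proof -
        have "inclusion_prob m es W \<beta> K i t \<omega> =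
            ratio_cap m (W es) (\<lambda>s. sample_history K s \<omega>) (\<lambda>j. \<beta> j \<omega>) {} i t"
          using prems by (intro inclusion_prob_eq_ratio_cap)
        also have "\<dots> = ratio_cap m w (\<lambda>s. sample_history K s \<omega>) (\<lambda>j. \<beta> j \<omega>) {} i t"
        proof (rule ratio_cap_weight_cong)
          fix s j assume s: "s \<in> {i..t}" and j: "j \<in> insert i (last (sample_history K s \<omega>))"
          have s': "s \<in> {1..length es}" using s i t by auto
          \<comment> \<open>Survival puts \<open>i\<close> into the provisional sample at time
            \<open>s\<close>, where the scheme guarantees positive weights; there
            \<open>positive_weight\<close> changes nothing.\<close>
          have "i \<in> K s \<omega>" using K_antimono[of i s t] s iK prems by auto
          then have "j \<in> provisional_sample K s \<omega>"
            using j K_subset_P[of s] s' by (auto simp: last_sample_history N_def)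
          then show "W es (sample_history K s \<omega>) j = w (sample_history K s \<omega>) j"
            using sampling_step(2)[OF K elim(3) s'] by (simp add: w_def positive_weight_def)
        qed
        also have "\<dots> = Q (b \<omega>)"
          unfolding Q_def by (rule cap_eq[OF prems iK])
        finally show ?thesis .
      qed
      \<comment> \<open>If \<open>i\<close> is not retained, both sides are 0 by
        \<open>surv\<close>.\<close>
      then have "edge_estimator m es W \<beta> K i t \<omega> = indicator {..Q (b \<omega>)} (\<beta> i \<omega>) / Q (b \<omega>)"
        using surv by (auto simp: edge_estimator_def indicator_def)
      with cap_pos[OF prems] cap_le_1[OF prems] show ?case by (simp add: Q_def)
    qed
    have "has_bochner_integral M (\<lambda>\<omega>. indicator {..Q (b \<omega>)} (\<beta> i \<omega>) / Q (b \<omega>)) 1"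
      using main by (intro indep_uniform_indicator_div indep_Q unif i) auto
    then have "has_bochner_integral M (edge_estimator m es W \<beta> K i t) 1"
      using main est_meas
      by (subst has_bochner_integral_cong_AE[where g = "\<lambda>\<omega>. indicator {..Q (b \<omega>)} (\<beta> i \<omega>) / Q (b \<omega>)"])
        (auto intro: borel_measurable_has_bochner_integral)
    then show ?thesis using True
      by (simp add: unbiased_estimator_def edge_indicator_def has_bochner_integral_iff)
  qed
qed

end
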